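(* Let $\theta=(\theta(n))_{n\in\mathbb N}$ be a bounded sequence of complex numbers and let $u=(u_n)_{n\in\mathbb N}$ be a strictly increasing sequence of integers. Suppose that there are $\delta<1$ and a constant $C$ such that for all $N\ge 1$ $$\sup_{\lambda\in\mathbb R}\left|\sum_{k=0}^{N-1}\theta(k)e^{2i\pi\lambda u_k}\right|\le C N^{\delta}.$$ Let $\alpha$ be an irrational number and $(\mathbb T,\mathcal B,\mu,R_\alpha)$ the corresponding rotation dynamical system. Then for all $f\in A(\mathbb T)$ and all $\beta>\delta$, $$\frac1{N^{\beta}}\sum_{k=0}^{N-1}\theta(k)f(R_\alpha^{u_k}x)\longrightarrow 0\quad\text{as }N\to+\infty,$$ uniformly in $x\in\mathbb T$.
   Context: $\mathbb N=\{0,1,2,\dots\}$; $\mathbb T=\mathbb R/\mathbb Z$ with its Borel $\sigma$-algebra $\mathcal B$ and Haar probability measure $\mu$; $R_\alpha x=x+\alpha\bmod 1$. $A(\mathbb T)$ is the set of functions with summable Fourier coefficients, i.e. $f(x)=\sum_{j\in\mathbb Z}\hat f(j)e^{2i\pi jx}$ for $x\in\mathbb T$, with $\sum_{j\in\mathbb Z}|\hat f(j)|<\infty$. *)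

theory Defs
  imports "HOL-Analysis.Analysis"
begin

text \<open>\<open>\<real>/\<int>\<close> is represented by its fundamental domain \<open>[0,1)\<close>, with addition mod 1
  computed by \<^const>\<open>frac\<close>. Functions on it are functions on the reals of which only the values
  on \<open>[0,1)\<close> matter.\<close>

definition torus :: "real set" where
  "torus = {0..<1}"

definition haar_torus :: "real measure" where
  "haar_torus = restrict_space lborel torus"

definition rotation :: "real \<Rightarrow> real \<Rightarrow> real" where
  "rotation \<alpha> x = frac (x + \<alpha>)"

definition int_iterate :: "'a set \<Rightarrow> ('a \<Rightarrow> 'a) \<Rightarrow> int \<Rightarrow> 'a \<Rightarrow> 'a" where
  "int_iterate X T n = (if 0 \<le> n then T ^^ nat n else the_inv_into X T ^^ nat (- n))"

definition fourier_coeff :: "(real \<Rightarrow> complex) \<Rightarrow> int \<Rightarrow> complex" where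
  "fourier_coeff f j =
     (LINT x|haar_torus. f x * exp (- (2 * \<i> * of_real pi * of_int j * of_real x)))"

definition wiener_algebra :: "(real \<Rightarrow> complex) set" where
  "wiener_algebra = {f. integrable haar_torus f \<and>
     (\<lambda>j. norm (fourier_coeff f j)) summable_on UNIV \<and>
     (\<forall>x\<in>torus.
        ((\<lambda>j. fourier_coeff f j * exp (2 * \<i> * of_real pi * of_int j * of_real x)) has_sum f x) UNIV)}"

lemma emeasure_haar_torus_space: "emeasure haar_torus (space haar_torus) = 1"
  by (simp add: haar_torus_def torus_def space_restrict_space emeasure_restrict_space)

lemma bij_betw_rotation: "bij_betw (rotation \<alpha>) torus torus"
proof (rule bij_betw_byWitness[where f' = "rotation (- \<alpha>)"])
  have inv: "rotation (- a) (rotation a x) = x" if "x \<in> torus" for a x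
  proof -
    have "frac (x + a) + - a = x + of_int (- \<lfloor>x + a\<rfloor>)"
      by (simp add: frac_def)
    then have "frac (frac (x + a) + - a) = frac x"
      by (metis frac_add_of_int_right)
    with that show ?thesis
      by (simp add: rotation_def torus_def frac_eq)
  qed
  show "\<forall>x\<in>torus. rotation (- \<alpha>) (rotation \<alpha> x) = x" using inv by blast
  show "\<forall>x\<in>torus. rotation \<alpha> (rotation (- \<alpha>) x) = x" using inv[of _ "- \<alpha>"] by simp
qed (auto simp: rotation_def torus_def frac_ge_0 frac_lt_1)

end

theory Submission imports Defs begin

text \<open>Each character e_j(y) = exp(2 \<i> pi j y) is an eigenfunction of the rotation: moving x
  by n \<alpha> multiplies e_j by exp(2 \<i> pi j \<alpha> n). Hence the weighted sum of a function
  with absolutely summable Fourier coefficients c_j is the series of c_j e_j(x) times the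
  exponential sum at frequency t = j \<alpha>. The hypothesis bounds that sum by C N^\<delta> for
  all t at once, so the weighted sum is at most A C N^\<delta>, where A is the sum of the |c_j|,
  whatever x is. Division by N^\<beta> leaves a negative power of N.
  \<open>int_iterate_rotation\<close> gives the orbit in closed form and
  \<open>norm_weighted_rotation_sum_le\<close> carries out the estimate.\<close>

lemma rotation_funpow:
  assumes "x \<in> torus"
  shows "(rotation \<alpha> ^^ n) x = frac (x + of_nat n * \<alpha>)"
proof (induction n)
  case 0
  then show ?case using assms by (simp add: torus_def frac_eq)
next
  case (Suc n)
  have "frac (x + of_nat n * \<alpha>) + \<alpha> = (x + of_nat (Suc n) * \<alpha>) + of_int (- \<lfloor>x + of_nat n * \<alpha>\<rfloor>)"
    by (simp add: frac_def algebra_simps)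
  then show ?case
    using Suc by (simp only: funpow.simps o_apply rotation_def frac_add_of_int_right)
qed

text \<open>Identifies the inverse used for negative times. It is only meaningful on
  \<open>torus\<close>, since \<open>the_inv_into\<close> is unspecified off the image.\<close>

lemma the_inv_into_rotation:
  assumes "x \<in> torus"
  shows "the_inv_into torus (rotation \<alpha>) x = rotation (- \<alpha>) x"
proof (rule the_inv_into_f_eq)
  show "inj_on (rotation \<alpha>) torus"
    using bij_betw_rotation by (rule bij_betw_imp_inj_on)
  show "rotation (- \<alpha>) x \<in> torus"
    by (simp add: rotation_def torus_def frac_lt_1)
  have "frac (x + - \<alpha>) + \<alpha> = x + of_int (- \<lfloor>x + - \<alpha>\<rfloor>)"
    by (simp add: frac_def)
  then show "rotation \<alpha> (rotation (- \<alpha>) x) = x"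
    unfolding rotation_def using assms
    by (simp only: frac_add_of_int_right) (simp add: torus_def frac_eq)
qed

text \<open>The values of \<open>u\<close> may be negative, so forward and backward iterates need
  one common formula.\<close>

lemma int_iterate_rotation:
  assumes "x \<in> torus"
  shows "int_iterate torus (rotation \<alpha>) n x = frac (x + of_int n * \<alpha>)"
proof (cases "0 \<le> n")
  case True
  then show ?thesis using rotation_funpow[OF assms, of "nat n" \<alpha>]
    by (simp add: int_iterate_def)
next
  case False
  have "(the_inv_into torus (rotation \<alpha>) ^^ m) x = (rotation (- \<alpha>) ^^ m) x" for m
  proof (induction m)
    case (Suc m)
    \<comment> \<open>The inverse agrees with the rotation by -\<alpha> only on
      \<open>torus\<close>, so the orbit must be seen to stay there.\<close>
    have "(rotation (- \<alpha>) ^^ m) x \<in> torus"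
      using rotation_funpow[OF assms] by (simp add: torus_def frac_lt_1)
    then show ?case using Suc by (simp add: the_inv_into_rotation)
  qed simp
  then show ?thesis
    using False rotation_funpow[OF assms, of "nat (- n)" "- \<alpha>"]
    by (simp add: int_iterate_def)
qed

text \<open>Justifies exchanging the finite sum over times with the Fourier series. For infinite
  \<open>I\<close> both sums are 0 by convention.\<close>

lemma has_sum_finite_sum:
  fixes f :: "'i \<Rightarrow> 'a \<Rightarrow> 'b::{comm_monoid_add, topological_comm_monoid_add}"
  assumes "\<And>i. i \<in> I \<Longrightarrow> (f i has_sum s i) A"
  shows "((\<lambda>x. \<Sum>i\<in>I. f i x) has_sum (\<Sum>i\<in>I. s i)) A"
  using assms by (induction I rule: infinite_finite_induct) (auto intro: has_sum_add)

lemma exp_int_frac: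
  "exp (2 * \<i> * of_real pi * of_int j * of_real (frac y)) =
   exp (2 * \<i> * of_real pi * of_int j * of_real y)"
proof -
  have "exp (2 * \<i> * of_real pi * of_int j * of_real y) =
      exp (2 * \<i> * of_real pi * of_int j * of_real (frac y)) *
      exp (of_int (j * \<lfloor>y\<rfloor>) * (2 * of_real pi * \<i>) :: complex)"
    unfolding exp_add[symmetric] by (simp add: frac_def algebra_simps)
  moreover have "exp (of_int (j * \<lfloor>y\<rfloor>) * (2 * of_real pi * \<i>)) = (1::complex)"
    unfolding exp_eq_1 by (auto intro!: exI[of _ "j * \<lfloor>y\<rfloor>"])
  ultimately show ?thesis by simp
qed

text \<open>Expanding \<open>f\<close> in its Fourier series and exchanging the sums, the \<open>j\<close>-th term carries the
  exponential sum of the hypothesis at frequency \<open>j * \<alpha>\<close>, so the rotation sums are bounded by the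
  Wiener norm of \<open>f\<close> times a bound on these exponential sums that does not depend on \<open>j\<close>.\<close>

lemma norm_weighted_rotation_sum_le:
  fixes \<theta> :: "nat \<Rightarrow> complex" and u :: "nat \<Rightarrow> int"
  assumes f: "f \<in> wiener_algebra" and x: "x \<in> torus"
    and B: "\<And>t::real. norm (\<Sum>k<N. \<theta> k * exp (2 * \<i> * of_real pi * of_real t * of_int (u k))) \<le> B"
  shows "norm (\<Sum>k<N. \<theta> k * f (int_iterate torus (rotation \<alpha>) (u k) x))
    \<le> (\<Sum>\<^sub>\<infinity>j. norm (fourier_coeff f j)) * B"
proof -
  let ?e = "\<lambda>j y. exp (2 * \<i> * of_real pi * of_int j * of_real y) :: complex"
  let ?c = "fourier_coeff f"
  let ?S = "\<lambda>t. \<Sum>k<N. \<theta> k * exp (2 * \<i> * of_real pi * of_real t * of_int (u k))"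
  have "((\<lambda>j. \<theta> k * (?c j * ?e j (x + of_int (u k) * \<alpha>))) has_sum
      \<theta> k * f (int_iterate torus (rotation \<alpha>) (u k) x)) UNIV" for k
  proof -
    have "frac (x + of_int (u k) * \<alpha>) \<in> torus"
      by (simp add: torus_def frac_lt_1)
    with f have "((\<lambda>j. ?c j * ?e j (frac (x + of_int (u k) * \<alpha>))) has_sum
      f (frac (x + of_int (u k) * \<alpha>))) UNIV"
      unfolding wiener_algebra_def by blast
    then show ?thesis
      unfolding exp_int_frac int_iterate_rotation[OF x] by (rule has_sum_cmult_right)
  qed
  then have "((\<lambda>j. \<Sum>k<N. \<theta> k * (?c j * ?e j (x + of_int (u k) * \<alpha>))) has_sum
      (\<Sum>k<N. \<theta> k * f (int_iterate torus (rotation \<alpha>) (u k) x))) UNIV"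
    by (intro has_sum_finite_sum) auto
  \<comment> \<open>Multiplicativity of the character separates x from the time
    \<open>u k\<close>.\<close>
  moreover have "(\<Sum>k<N. \<theta> k * (?c j * ?e j (x + of_int (u k) * \<alpha>))) =
      ?c j * ?e j x * ?S (of_int j * \<alpha>)" for j
    by (simp add: sum_distrib_left ring_distribs exp_add mult_ac)
  ultimately have sum: "((\<lambda>j. ?c j * ?e j x * ?S (of_int j * \<alpha>)) has_sum
      (\<Sum>k<N. \<theta> k * f (int_iterate torus (rotation \<alpha>) (u k) x))) UNIV"
    by simp
  have "((\<lambda>j. norm (?c j) * B) has_sum (\<Sum>\<^sub>\<infinity>j. norm (?c j)) * B) UNIV"
    using f by (intro has_sum_cmult_left has_sum_infsum) (simp add: wiener_algebra_def)
  with sum show ?thesis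
  proof (rule norm_infsum_le)
    show "norm (?c j * ?e j x * ?S (of_int j * \<alpha>)) \<le> norm (?c j) * B" for j
    proof -
      \<comment> \<open>Here x drops out of the estimate, which is what makes the convergence
        uniform.\<close>
      have "norm (?e j x) = 1" by simp
      then show ?thesis
        using mult_left_mono[OF B[of "of_int j * \<alpha>"], of "norm (?c j)"]
        by (simp only: norm_mult mult_1_right norm_ge_zero)
    qed
  qed
qed

theorem proposition6:
  fixes \<theta> :: "nat \<Rightarrow> complex" and u :: "nat \<Rightarrow> int" and \<delta> C \<alpha> :: real
  assumes "bounded (range \<theta>)"
    and "strict_mono u"
    and "\<delta> < 1"
    and "\<And>N::nat. N \<ge> 1 \<Longrightarrow>
      (SUP t::real. norm (\<Sum>k<N. \<theta> k * exp (2 * \<i> * of_real pi * of_real t * of_int (u k))))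
        \<le> C * real N powr \<delta>"
    and "\<alpha> \<notin> \<rat>"
  shows "\<forall>f\<in>wiener_algebra. \<forall>\<beta>>\<delta>.
    uniform_limit torus
      (\<lambda>N x. 1 / of_real (real N powr \<beta>) *
         (\<Sum>k<N. \<theta> k * f (int_iterate torus (rotation \<alpha>) (u k) x)))
      (\<lambda>x. 0) sequentially"
proof (intro ballI allI impI)
  fix f \<beta> assume f: "f \<in> wiener_algebra" and \<beta>: "\<delta> < \<beta>"
  define A where "A = (\<Sum>\<^sub>\<infinity>j. norm (fourier_coeff f j))"
  have expsum: "norm (\<Sum>k<N. \<theta> k * exp (2 * \<i> * of_real pi * of_real t * of_int (u k)))
      \<le> C * real N powr \<delta>" if "N \<ge> 1" for N and t :: real
  proof -
    \<comment> \<open>A real \<open>SUP\<close> dominates its members only if the family is bounded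
      above; the triangle inequality supplies a bound free of the frequency.\<close>
    have "norm (\<Sum>k<N. \<theta> k * exp (2 * \<i> * of_real pi * of_real s * of_int (u k)))
        \<le> (\<Sum>k<N. norm (\<theta> k))" for s :: real
      by (rule sum_norm_le) (simp add: norm_mult)
    then have "bdd_above (range (\<lambda>s::real.
        norm (\<Sum>k<N. \<theta> k * exp (2 * \<i> * of_real pi * of_real s * of_int (u k)))))"
      by (intro bdd_aboveI2)
    then show ?thesis
      using assms(4)[OF that] by (meson UNIV_I cSUP_upper order_trans)
  qed
  have bound: "norm (1 / of_real (real N powr \<beta>) *
         (\<Sum>k<N. \<theta> k * f (int_iterate torus (rotation \<alpha>) (u k) x)))
      \<le> A * C * real N powr (\<delta> - \<beta>)" if "N \<ge> 1" "x \<in> torus" for N x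
  proof -
    have "norm (\<Sum>k<N. \<theta> k * f (int_iterate torus (rotation \<alpha>) (u k) x))
        \<le> A * (C * real N powr \<delta>)"
      unfolding A_def using f that expsum by (intro norm_weighted_rotation_sum_le)
    then show ?thesis
      using that by (simp add: norm_mult norm_divide powr_diff divide_right_mono mult.assoc)
  qed
  have "((\<lambda>n. real n powr (\<delta> - \<beta>)) \<longlongrightarrow> 0) sequentially"
    using \<beta> by (intro tendsto_neg_powr filterlim_real_sequentially) simp
  then have "((\<lambda>n. A * C * real n powr (\<delta> - \<beta>)) \<longlongrightarrow> 0) sequentially"
    by (rule tendsto_mult_right_zero)
  show "uniform_limit torus
      (\<lambda>N x. 1 / of_real (real N powr \<beta>) *
         (\<Sum>k<N. \<theta> k * f (int_iterate torus (rotation \<alpha>) (u k) x)))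
      (\<lambda>x. 0) sequentially"
  proof (rule uniform_limitI)
    fix e :: real assume "e > 0"
    with \<open>((\<lambda>n. A * C * real n powr (\<delta> - \<beta>)) \<longlongrightarrow> 0) sequentially\<close>
    have "\<forall>\<^sub>F n in sequentially. A * C * real n powr (\<delta> - \<beta>) < e"
      by (rule order_tendstoD)
    then show "\<forall>\<^sub>F N in sequentially. \<forall>x\<in>torus.
        dist (1 / of_real (real N powr \<beta>) *
         (\<Sum>k<N. \<theta> k * f (int_iterate torus (rotation \<alpha>) (u k) x))) 0 < e"
      \<comment> \<open>The bound on the averages is available from N = 1 on.\<close>
      using eventually_ge_at_top[of 1]
    proof eventually_elim
      case (elim N)
      then show ?case using bound[of N] unfolding dist_norm diff_zero by (blast intro: le_less_trans)
    qed
  qed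
qed

end
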